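(* Let $\rho$ be a positive integer and let $\alpha\in\mathbb{Q}\setminus\mathbb{Z}$. Then for each integer $n\geq 1$, $$\sum_{k=0}^{n-1}(2k+\alpha)\binom{-\alpha}{k}^\rho\equiv 0\pmod{N_{\alpha,n}}.$$
   Context: For $x\in\mathbb{Q}$ and an integer $k\ge 0$, $\binom{x}{k}=\frac{x(x-1)\cdots(x-k+1)}{k!}$ (with $\binom{x}{0}=1$). For $\alpha\in\mathbb{Q}\setminus\mathbb{Z}$ and a positive integer $n$, $N_{\alpha,n}$ denotes the numerator (a positive integer, the fraction being in lowest terms) of the positive rational number $n\cdot\left|\binom{-\alpha}{n}\right|$. For a rational number $x$ and a positive integer $N$, $x\equiv 0\pmod N$ means that $x=N\cdot\frac{a}{b}$ with $a,b\in\mathbb{Z}$, $b\neq 0$ and $\gcd(b,N)=1$. *)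

theory Defs
  imports Complex_Main
begin

definition N_num :: "rat \<Rightarrow> nat \<Rightarrow> int" where
  "N_num \<alpha> n = fst (quotient_of (of_nat n * \<bar>(- \<alpha>) gchoose n\<bar>))"

text \<open>Congruence to zero for a rational number \<open>x\<close>: the cofactor of \<open>N\<close> has to be a
  fraction whose denominator is coprime to \<open>N\<close>, not necessarily an integer.\<close>

definition rat_cong_zero :: "rat \<Rightarrow> int \<Rightarrow> bool" where
  "rat_cong_zero x N \<longleftrightarrow>
    (\<exists>a b :: int. b \<noteq> 0 \<and> gcd b N = 1 \<and> x = of_int N * (of_int a / of_int b))"

end

theory Submission
  imports Defs "HOL-Computational_Algebra.Computational_Algebra"
begin

text \<open>
  The congruence is first proved for a negative integer in place of \<open>\<alpha>\<close>, where it is a genuine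
  divisibility, and then carried over to \<open>\<alpha>\<close> by approximating \<open>- \<alpha>\<close> with a natural number.

  For \<open>- \<alpha> = m\<close> with \<open>m \<ge> n\<close> the claim says that \<open>n * (m choose n)\<close> divides
  \<open>\<Sum>k<n. (2 * k - m) * (m choose k) ^ \<rho>\<close>.  Replace binomial coefficients by Gaussian ones: in
  \<open>\<int>[q]\<close> the monic polynomial \<open>D = (q ^ n - 1) * [m choose n]\<close> divides
  \<open>T = \<Sum>k<n. (q ^ k - q ^ (m - k)) * [m choose k] ^ \<rho>\<close>, and since both vanish at \<open>q = 1\<close>,
  comparing derivatives at \<open>1\<close> gives the integer statement (\<open>binomial_dvd_sum\<close>).
  The gain is that divisibility by \<open>D\<close> can be tested root by root, because all roots of \<open>D\<close> are
  simple.  A root \<open>\<zeta>\<close> is a root of unity of some order \<open>d\<close>, and it satisfies \<open>d dvd n\<close> or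
  \<open>m mod d < n mod d\<close> (\<open>order_gauss_binomial\<close>).  By the \<open>q\<close>-analogue of Lucas' theorem
  (\<open>gauss_binomial_lucas\<close>) the terms of \<open>T(\<zeta>)\<close> factor along \<open>k = d * Q + r\<close>, so each block of
  length \<open>d\<close> is a multiple of the sum for \<open>m mod d\<close> in place of \<open>m\<close>.  That sum is antisymmetric
  under \<open>r \<mapsto> m mod d - r\<close> and is therefore \<open>0\<close>; the condition on \<open>n\<close> ensures that the last, possibly
  incomplete, block has lost only zero terms (\<open>gauss_binomial_sum_vanishes\<close>).

  For the transfer let \<open>N\<close> be the modulus.  The denominator of \<open>\<alpha>\<close> is coprime to \<open>N\<close>
  (\<open>coprime_denominator_N_num\<close>), so \<open>- \<alpha>\<close> is congruent to some natural number \<open>m \<ge> n\<close> modulo any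
  power of \<open>N\<close>.  If the power is high enough to absorb the factors that \<open>n!\<close> shares with \<open>N\<close>, then
  Vandermonde's identity shows \<open>(- \<alpha> gchoose k) \<equiv> (m choose k)\<close> modulo \<open>N\<close> for all \<open>k \<le> n\<close>
  (\<open>gbinomial_cong\<close>).  Hence \<open>N\<close> divides \<open>n * (m choose n)\<close>, thus also the sum for \<open>m\<close>, and the sum
  for \<open>- \<alpha>\<close> is congruent to it.
\<close>

section \<open>Gaussian binomial coefficients\<close>

text \<open>
  The base \<open>q\<close> is an arbitrary ring element, so that the same function gives the Gaussian polynomial
  (for \<open>q = [:0, 1:]\<close>), its values at complex numbers, and the ordinary binomial coefficients.
\<close>

fun gauss_binomial :: "'a::comm_semiring_1 \<Rightarrow> nat \<Rightarrow> nat \<Rightarrow> 'a" where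
  "gauss_binomial q n 0 = 1"
| "gauss_binomial q 0 (Suc k) = 0"
| "gauss_binomial q (Suc n) (Suc k) =
     gauss_binomial q n k + q ^ Suc k * gauss_binomial q n (Suc k)"

lemma gauss_binomial_eq_0: "n < k \<Longrightarrow> gauss_binomial q n k = 0"
  by (induction q n k rule: gauss_binomial.induct) auto

lemma gauss_binomial_self [simp]: "gauss_binomial q n n = 1"
  by (induction n) (auto simp: gauss_binomial_eq_0)

lemma gauss_binomial_1: "gauss_binomial 1 n k = of_nat (n choose k)"
  by (induction "1::'a" n k rule: gauss_binomial.induct) auto

lemma poly_gauss_binomial: "poly (gauss_binomial p n k) z = gauss_binomial (poly p z) n k"
  by (induction p n k rule: gauss_binomial.induct) auto

text \<open>
  This replaces the quotient formula for Gaussian coefficients and needs no division: it is valid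
  also where the factors \<open>q ^ i - 1\<close> vanish.  In the induction both sides turn out to equal
  \<open>[n choose k] * (q ^ Suc n - 1)\<close>.
\<close>

lemma gauss_binomial_ratio:
  fixes q :: "'a::comm_ring_1"
  assumes "k \<le> n"
  shows "gauss_binomial q n (Suc k) * (q ^ Suc k - 1) = gauss_binomial q n k * (q ^ (n - k) - 1)"
  using assms
proof (induction n arbitrary: k)
  case (Suc n)
  show ?case
  proof (cases "k = Suc n")
    case False
    then have k: "k \<le> n" using Suc.prems by simp
    have pw: "q ^ Suc n = q ^ Suc k * q ^ (n - k)"
      by (subst power_add[symmetric]) (use k in simp)
    have "gauss_binomial q (Suc n) (Suc k) * (q ^ Suc k - 1)
        = gauss_binomial q n k * (q ^ Suc k - 1)
          + q ^ Suc k * (gauss_binomial q n (Suc k) * (q ^ Suc k - 1))"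
      by (simp add: algebra_simps)
    also have "\<dots> = gauss_binomial q n k * (q ^ Suc n - 1)"
      unfolding Suc.IH[OF k] pw by (simp add: algebra_simps)
    finally have left: "gauss_binomial q (Suc n) (Suc k) * (q ^ Suc k - 1)
      = gauss_binomial q n k * (q ^ Suc n - 1)" .
    have right: "gauss_binomial q (Suc n) k * (q ^ (Suc n - k) - 1)
      = gauss_binomial q n k * (q ^ Suc n - 1)"
    proof (cases k)
      case (Suc j)
      have j: "j \<le> n" "Suc n - k = n - j" using k Suc by auto
      have pw: "q ^ Suc n = q ^ Suc j * q ^ (n - j)"
        by (subst power_add[symmetric]) (use j in simp)
      have "gauss_binomial q (Suc n) k * (q ^ (Suc n - k) - 1)
        = gauss_binomial q n j * (q ^ (n - j) - 1)
          + q ^ Suc j * gauss_binomial q n (Suc j) * (q ^ (n - j) - 1)"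
        unfolding j Suc by (simp add: algebra_simps)
      also have "\<dots> = gauss_binomial q n k * (q ^ Suc n - 1)"
        unfolding Suc.IH[OF j(1), symmetric] pw Suc by (simp add: algebra_simps)
      finally show ?thesis .
    qed simp
    from left right show ?thesis by simp
  qed (simp add: gauss_binomial_eq_0)
qed simp

lemma gauss_binomial_absorption:
  fixes q :: "'a::comm_ring_1"
  assumes "k \<le> n"
  shows "gauss_binomial q (Suc n) (Suc k) * (q ^ Suc k - 1)
           = (q ^ Suc n - 1) * gauss_binomial q n k"
    and "gauss_binomial q (Suc n) k * (q ^ (Suc n - k) - 1)
           = (q ^ Suc n - 1) * gauss_binomial q n k"
proof -
  have pw: "q ^ Suc n = q ^ Suc k * q ^ (n - k)"
    by (subst power_add[symmetric]) (use assms in simp)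
  have "gauss_binomial q (Suc n) (Suc k) * (q ^ Suc k - 1)
      = gauss_binomial q n k * (q ^ Suc k - 1)
        + q ^ Suc k * (gauss_binomial q n (Suc k) * (q ^ Suc k - 1))"
    by (simp add: algebra_simps)
  also have "\<dots> = (q ^ Suc n - 1) * gauss_binomial q n k"
    unfolding gauss_binomial_ratio[OF assms] pw by (simp add: algebra_simps)
  finally show 1: "gauss_binomial q (Suc n) (Suc k) * (q ^ Suc k - 1)
      = (q ^ Suc n - 1) * gauss_binomial q n k" .
  show "gauss_binomial q (Suc n) k * (q ^ (Suc n - k) - 1) = (q ^ Suc n - 1) * gauss_binomial q n k"
    using gauss_binomial_ratio[of k "Suc n" q] assms 1 by simp
qed

text \<open>
  The recurrence treats \<open>k\<close> and \<open>n - k\<close> differently, so the symmetry has to come from the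
  absorption identities; cancelling \<open>q ^ i - 1\<close> is what the assumption on \<open>q\<close> is for.
\<close>

lemma gauss_binomial_symmetric:
  fixes q :: "'a::idom"
  assumes "\<And>i. 0 < i \<Longrightarrow> i \<le> n \<Longrightarrow> q ^ i \<noteq> 1" and "k \<le> n"
  shows "gauss_binomial q n (n - k) = gauss_binomial q n k"
  using assms
proof (induction n arbitrary: k)
  case (Suc n)
  show ?case
  proof (cases "k = Suc n")
    case False
    then have k: "k \<le> n" "Suc n - k = Suc (n - k)" using Suc.prems by auto
    have "gauss_binomial q (Suc n) (Suc n - k) * (q ^ (Suc n - k) - 1)
        = (q ^ Suc n - 1) * gauss_binomial q n (n - k)"
      unfolding k by (rule gauss_binomial_absorption) simp
    also have "\<dots> = gauss_binomial q (Suc n) k * (q ^ (Suc n - k) - 1)"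
      using Suc.IH[of k] Suc.prems k gauss_binomial_absorption(2)[OF k(1), of q]
      by (simp del: power_Suc gauss_binomial.simps)
    finally show ?thesis using Suc.prems(1)[of "Suc n - k"] k by simp
  qed simp
qed simp

lemma gauss_binomial_nonzero:
  fixes q :: "'a::idom"
  assumes "\<And>i. 0 < i \<Longrightarrow> i \<le> n \<Longrightarrow> q ^ i \<noteq> 1" and "k \<le> n"
  shows "gauss_binomial q n k \<noteq> 0"
  using assms(2)
proof (induction k)
  case (Suc k)
  then show ?case using gauss_binomial_ratio[of k n q] assms(1)[of "n - k"] by force
qed simp

text \<open>
  From here on a number \<open>d\<close> with \<open>q ^ i = 1 \<longleftrightarrow> d dvd i\<close> plays the role of the order of \<open>q\<close>.  The value
  \<open>d = 0\<close> stands for infinite order; as \<open>x mod 0 = x\<close> and \<open>x div 0 = 0\<close>, the statements below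
  remain correct in this case.
\<close>

lemma power_mod_ord:
  fixes q :: "'a::monoid_mult"
  assumes ord: "\<And>i. q ^ i = 1 \<longleftrightarrow> d dvd i"
  shows "q ^ k = q ^ (k mod d)"
proof -
  have "q ^ d = 1" by (simp add: ord)
  then have "q ^ (d * (k div d) + k mod d) = q ^ (k mod d)"
    by (simp only: power_add power_mult power_one mult_1_left)
  then show ?thesis by simp
qed

text \<open>
  The \<open>q\<close>-analogue of Lucas' theorem.  The recurrence for \<open>n\<close> splits into that for the digit \<open>n mod d\<close>
  and, when a carry occurs, Pascal's rule for \<open>n div d\<close>; the carry works because
  \<open>[d choose k] = 0\<close> for \<open>0 < k < d\<close>.
\<close>

lemma gauss_binomial_lucas:
  fixes q :: "'a::idom"
  assumes ord: "\<And>i. q ^ i = 1 \<longleftrightarrow> d dvd i"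
  shows "gauss_binomial q n k =
    of_nat (n div d choose (k div d)) * gauss_binomial q (n mod d) (k mod d)"
proof (cases "d = 0")
  case False
  have mid: "gauss_binomial q d k = 0" if "0 < k" "k < d" for k
  proof -
    from that obtain j e where [simp]: "k = Suc j" "d = Suc e" by (metis gr0_implies_Suc less_zeroE not0_implies_Suc)
    have "gauss_binomial q d k * (q ^ k - 1) = 0"
      using gauss_binomial_absorption(1)[of j e q] ord[of d] that by simp
    moreover have "q ^ k \<noteq> 1" using that ord[of k] nat_dvd_not_less[of k d] by blast
    ultimately show ?thesis by simp
  qed
  note qmod = power_mod_ord[OF ord]
  show ?thesis
  proof (induction n arbitrary: k)
    case 0
    show ?case
    proof (cases "k = 0")
      case k: False
      then have "k div d > 0 \<or> k mod d > 0" using False by (metis div_mult_mod_eq add_0 mult_0 neq0_conv)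
      then show ?thesis using k by (auto simp: gauss_binomial_eq_0 binomial_eq_0)
    qed simp
  next
    case (Suc n)
    show ?case
    proof (cases k)
      case k: (Suc j)
      have rec: "gauss_binomial q (Suc n) k =
          of_nat (n div d choose (j div d)) * gauss_binomial q (n mod d) (j mod d)
          + q ^ (k mod d) * (of_nat (n div d choose (k div d)) * gauss_binomial q (n mod d) (k mod d))"
        unfolding k gauss_binomial.simps
        by (intro arg_cong2[where f = "(+)"] arg_cong2[where f = "(*)"] Suc.IH qmod)
      show ?thesis
      proof (cases "d dvd k")
        case dk: True
        then obtain e where e: "k = d * Suc e" using k by (metis dvdE mult_0_right not0_implies_Suc nat.distinct(1))
        define c where "c = d - 1"
        have "j = c + d * e" "c < d" using e k False by (auto simp: c_def algebra_simps)
        then have "j div d = e" "j mod d = c" by auto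
        then have j: "j div d = e" "j mod d = d - 1" unfolding c_def by blast+
        have kk: "k div d = Suc e" "k mod d = 0" using e False by auto
        show ?thesis
        proof (cases "Suc (n mod d) = d")
          case True
          then have "Suc n mod d = 0" "Suc n div d = Suc (n div d)" "d - 1 = n mod d"
            by (auto simp: mod_Suc div_Suc)
          then show ?thesis unfolding rec j kk by simp
        next
          case F: False
          then have "n mod d < d - 1" using mod_less_divisor[of d n] False by linarith
          moreover have "Suc n mod d = Suc (n mod d)" "Suc n div d = n div d"
            using F by (auto simp: mod_Suc div_Suc)
          ultimately show ?thesis unfolding rec j kk by (simp add: gauss_binomial_eq_0)
        qed
      next
        case dk: False
        have kd: "k mod d < d" "0 < k mod d" using dk False by (auto simp: dvd_eq_mod_eq_0)
        have km: "k mod d = Suc (j mod d)" "k div d = j div d"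
          using dk False unfolding k by (auto simp: mod_Suc div_Suc dvd_eq_mod_eq_0 split: if_splits)
        have rec': "gauss_binomial q (Suc n) k =
          of_nat (n div d choose (k div d)) * gauss_binomial q (Suc (n mod d)) (k mod d)"
          unfolding rec km by (simp add: algebra_simps)
        show ?thesis
        proof (cases "Suc (n mod d) = d")
          case True
          then have "Suc n mod d = 0" by (auto simp: mod_Suc)
          then show ?thesis unfolding rec' True using mid kd by (simp add: gauss_binomial_eq_0)
        next
          case F: False
          then have "Suc n mod d = Suc (n mod d)" "Suc n div d = n div d"
            using F by (auto simp: mod_Suc div_Suc)
          then show ?thesis unfolding rec' by simp
        qed
      qed
    qed simp
  qed
qed simp

section \<open>The sum at a root of unity\<close>

lemma sum_mult_div_mod:
  fixes c w :: "nat \<Rightarrow> 'a::comm_semiring_1"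
  shows "(\<Sum>k<n. c (k div d) * w (k mod d)) =
     (\<Sum>Q<n div d. c Q) * (\<Sum>r<d. w r) + c (n div d) * (\<Sum>r<n mod d. w r)"
proof (cases "d = 0")
  case False
  have block: "(\<Sum>k=Q*d..<Q*d+s. c (k div d) * w (k mod d)) = c Q * (\<Sum>r<s. w r)" if "s \<le> d" for Q s
  proof -
    have "(\<Sum>k=Q*d..<Q*d+s. c (k div d) * w (k mod d))
        = (\<Sum>r=0..<s. c ((r + Q*d) div d) * w ((r + Q*d) mod d))"
      using sum.shift_bounds_nat_ivl[of "\<lambda>k. c (k div d) * w (k mod d)" 0 "Q*d" s]
      by (simp add: add.commute)
    also have "\<dots> = (\<Sum>r<s. c Q * w r)"
      using that False by (intro sum.cong) auto
    finally show ?thesis by (simp add: sum_distrib_left)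
  qed
  have n: "n = n div d * d + n mod d" by simp
  have "(\<Sum>k<n. c (k div d) * w (k mod d))
      = (\<Sum>k<n div d * d. c (k div d) * w (k mod d))
        + (\<Sum>k=n div d * d..<n div d * d + n mod d. c (k div d) * w (k mod d))"
    by (subst n, subst lessThan_atLeast0, subst sum.atLeastLessThan_concat[symmetric, of 0 "n div d * d"])
       (auto simp: lessThan_atLeast0)
  also have "\<dots> = (\<Sum>Q<n div d. c Q * (\<Sum>r<d. w r)) + c (n div d) * (\<Sum>r<n mod d. w r)"
    using False block[of "n mod d" "n div d"] by (simp add: sum.nat_group[symmetric] block less_imp_le)
  finally show ?thesis by (simp add: sum_distrib_right)
qed (simp add: sum_distrib_left)

lemma ex_ord:
  fixes q :: "'a::idom"
  shows "\<exists>d. \<forall>i. q ^ i = 1 \<longleftrightarrow> d dvd i"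
proof (cases "\<exists>i>0. q ^ i = 1")
  case True
  define d where "d = (LEAST i. 0 < i \<and> q ^ i = 1)"
  have d: "0 < d" "q ^ d = 1"
    using LeastI_ex[of "\<lambda>i. 0 < i \<and> q ^ i = 1"] True unfolding d_def by auto
  have "q ^ i = 1 \<longleftrightarrow> d dvd i" for i
  proof -
    have "q ^ (d * (i div d) + i mod d) = q ^ (i mod d)"
      unfolding power_add power_mult d(2) by simp
    then have i: "q ^ i = q ^ (i mod d)" by simp
    show ?thesis
    proof
      assume "q ^ i = 1"
      then have "\<not> 0 < i mod d"
        using not_less_Least[of "i mod d" "\<lambda>i. 0 < i \<and> q ^ i = 1"] i d(1)
        unfolding d_def[symmetric] by auto
      then show "d dvd i" by auto
    qed (use i in auto)
  qed
  then show ?thesis by blast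
next
  case False
  then have "\<forall>i. q ^ i = 1 \<longleftrightarrow> 0 dvd i" by (metis dvd_0_left_iff not_gr_zero power_0)
  then show ?thesis by blast
qed

text \<open>
  By Lucas' theorem the summand at \<open>k\<close> is a function of \<open>k div d\<close> times a function \<open>w\<close> of \<open>k mod d\<close>.
  Since \<open>w\<close> is supported on \<open>{..m mod d}\<close> and antisymmetric there, its sum over any \<open>{..<t}\<close>
  with \<open>m mod d < t\<close> is \<open>0\<close>.
\<close>

lemma gauss_binomial_sum_vanishes:
  fixes q :: "'a::field_char_0"
  assumes ord: "\<And>i. q ^ i = 1 \<longleftrightarrow> d dvd i"
    and "n \<le> m" "\<rho> \<ge> 1" and n: "n mod d = 0 \<or> m mod d < n mod d"
  shows "(\<Sum>k<n. (q ^ k - q ^ (m - k)) * gauss_binomial q m k ^ \<rho>) = 0"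
proof (cases "d = 0")
  case False
  have q0: "q \<noteq> 0" using ord[of d] False by (auto simp: power_0_left)
  define s where "s = m mod d"
  have sd: "s < d" using False by (simp add: s_def)
  define w where "w r = (q ^ r - q ^ s / q ^ r) * gauss_binomial q s r ^ \<rho>" for r
  have w0: "(\<Sum>r<t. w r) = 0" if "s < t" for t
  proof -
    \<comment> \<open>terms with \<open>r > s\<close> vanish because their Gaussian coefficient does and \<open>\<rho> \<noteq> 0\<close>\<close>
    have eq: "(\<Sum>r<t. w r) = (\<Sum>r<Suc s. w r)"
      using that \<open>\<rho> \<ge> 1\<close> by (intro sum.mono_neutral_right) (auto simp: w_def gauss_binomial_eq_0)
    have "(\<Sum>r<Suc s. w r) = (\<Sum>r<Suc s. w (Suc s - Suc r))"
      by (rule sum.nat_diff_reindex[symmetric])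
    also have "\<dots> = (\<Sum>r<Suc s. - w r)"
    proof (intro sum.cong refl)
      fix r assume "r \<in> {..<Suc s}"
      then have r: "r \<le> s" by simp
      have sym: "gauss_binomial q s (s - r) = gauss_binomial q s r"
      proof (rule gauss_binomial_symmetric[OF _ r])
        fix i assume "0 < i" "i \<le> s"
        then show "q ^ i \<noteq> 1" using ord[of i] sd nat_dvd_not_less[of i d] by simp
      qed
      show "w (Suc s - Suc r) = - w r"
        using r q0 by (simp add: w_def sym power_diff field_simps)
    qed
    also have "\<dots> = - (\<Sum>r<Suc s. w r)" by (rule sum_negf)
    finally have "2 * (\<Sum>r<Suc s. w r) = 0" by (simp only: mult_2 add.left_inverse eq_neg_iff_add_eq_0)
    then show ?thesis by (simp only: eq mult_eq_0_iff) simp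
  qed
  have "(\<Sum>k<n. (q ^ k - q ^ (m - k)) * gauss_binomial q m k ^ \<rho>)
     = (\<Sum>k<n. of_nat (m div d choose (k div d)) ^ \<rho> * w (k mod d))"
  proof (intro sum.cong refl)
    fix k assume "k \<in> {..<n}"
    then have "q ^ (m - k) = q ^ m / q ^ k" using \<open>n \<le> m\<close> q0 by (simp add: power_diff)
    also have "\<dots> = q ^ s / q ^ (k mod d)"
      unfolding s_def by (metis power_mod_ord[OF ord])
    finally have "q ^ (m - k) = q ^ s / q ^ (k mod d)" .
    moreover have "q ^ k = q ^ (k mod d)" by (rule power_mod_ord[OF ord])
    moreover have "gauss_binomial q m k
        = of_nat (m div d choose (k div d)) * gauss_binomial q s (k mod d)"
      unfolding s_def by (rule gauss_binomial_lucas[OF ord])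
    ultimately show "(q ^ k - q ^ (m - k)) * gauss_binomial q m k ^ \<rho>
      = of_nat (m div d choose (k div d)) ^ \<rho> * w (k mod d)"
      by (simp add: w_def power_mult_distrib)
  qed
  also have "\<dots> = 0"
    using w0[OF sd] w0[of "n mod d"] n unfolding s_def[symmetric]
    by (subst sum_mult_div_mod[of "\<lambda>Q. of_nat (m div d choose Q) ^ \<rho>"]) auto
  finally show ?thesis .
qed (use assms in auto)

section \<open>Roots and divisibility of polynomials\<close>

lemma order_power_minus_1:
  fixes z :: "'a::field_char_0"
  assumes "0 < j"
  shows "order z ([:0, 1:] ^ j - 1) = (if z ^ j = 1 then 1 else 0)"
proof (cases "z ^ j = 1")
  case True
  have "z \<noteq> 0" using True assms by (auto simp: power_0_left)
  then have d: "poly (pderiv ([:0, 1:] ^ j - 1)) z \<noteq> 0"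
    using assms by (simp add: pderiv_diff pderiv_power pderiv_pCons)
  then have "[:0, 1:] ^ j - 1 \<noteq> (0 :: 'a poly)" by auto
  then show ?thesis using True order_pderiv[of "[:0, 1:] ^ j - 1" z] order_0I[OF d] by simp
qed (simp add: order_0I)

lemma X_power_neq_1: "0 < j \<Longrightarrow> [:0, 1:] ^ j \<noteq> (1 :: 'a::idom poly)"
proof
  assume "0 < j" "[:0, 1:] ^ j = (1 :: 'a poly)"
  then have "poly ([:0, 1:] ^ j) 0 = (1::'a)" by simp
  with \<open>0 < j\<close> show False by (simp add: power_0_left)
qed

text \<open>
  The multiplicity follows the ratio identity from \<open>k\<close> to \<open>k + 1\<close>: it gains a factor vanishing at \<open>z\<close>
  exactly when \<open>k \<equiv> n\<close> modulo \<open>d\<close> and loses one exactly when \<open>d dvd k + 1\<close>.  So it is switched on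
  when \<open>k mod d\<close> passes \<open>n mod d\<close> and off at the next multiple of \<open>d\<close>.
\<close>

lemma order_gauss_binomial:
  fixes z :: "'a::field_char_0"
  assumes ord: "\<And>i. z ^ i = 1 \<longleftrightarrow> d dvd i" and "k \<le> n"
  shows "order z (gauss_binomial [:0, 1:] n k) = (if n mod d < k mod d then 1 else 0)"
  using assms(2)
proof (induction k)
  case (Suc k)
  let ?G = "gauss_binomial ([:0, 1:] :: 'a poly) n" and ?X = "[:0, 1:] :: 'a poly"
  have G: "?G j \<noteq> 0" if "j \<le> n" for j
    by (rule gauss_binomial_nonzero[OF X_power_neq_1 that])
  have nz: "?G (Suc k) \<noteq> 0" "?G k \<noteq> 0" "?X ^ Suc k - 1 \<noteq> 0" "?X ^ (n - k) - 1 \<noteq> 0"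
    using Suc.prems X_power_neq_1[of "Suc k"] X_power_neq_1[of "n - k"] G[of "Suc k"] G[of k]
    by (auto simp del: power_Suc)
  have "order z (?G (Suc k) * (?X ^ Suc k - 1)) = order z (?G k * (?X ^ (n - k) - 1))"
    using Suc.prems by (simp only: gauss_binomial_ratio Suc_leD)
  then have "order z (?G (Suc k)) + order z (?X ^ Suc k - 1) = order z (?G k) + order z (?X ^ (n - k) - 1)"
    using nz by (simp only: order_mult mult_eq_0_iff simp_thms)
  then have eq: "order z (?G (Suc k)) + (if d dvd Suc k then 1 else 0) =
     (if n mod d < k mod d then 1 else 0) + (if d dvd n - k then 1 else 0)"
    using Suc by (simp only: order_power_minus_1 ord zero_less_Suc zero_less_diff Suc_le_eq Suc_leD)
  show ?case
  proof (cases "d = 0")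
    case False
    have nk: "d dvd n - k \<longleftrightarrow> n mod d = k mod d"
      using Suc.prems mod_eq_dvd_iff_nat[of k n d] by (auto simp: eq_commute)
    have "n mod d < d" "k mod d < d" using False by auto
    then show ?thesis using eq nk by (auto simp: mod_Suc dvd_eq_mod_eq_0 split: if_splits)
  qed (use eq Suc.prems in auto)
qed simp

lemma prod_linear_factors_dvd:
  fixes p :: "'a::idom poly"
  assumes "finite A" "\<And>z. z \<in> A \<Longrightarrow> poly p z = 0"
  shows "(\<Prod>z\<in>A. [:-z, 1:]) dvd p"
  using assms
proof (induction A arbitrary: p rule: finite_induct)
  case (insert a A)
  then obtain r where r: "p = [:-a, 1:] * r" using poly_eq_0_iff_dvd[of p a] by auto
  have "poly r z = 0" if "z \<in> A" for z
    using insert that by (auto simp: r)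
  then have "(\<Prod>z\<in>A. [:-z, 1:]) dvd r" by (rule insert.IH)
  then show ?case using insert.hyps unfolding r
    by (subst prod.insert) (auto intro!: mult_dvd_mono simp del: mult_pCons_left)
qed simp

text \<open>
  For a polynomial with simple roots, divisibility over the complex numbers is a statement about
  values only.
\<close>

lemma rsquarefree_dvd:
  fixes p r :: "complex poly"
  assumes "rsquarefree p" "\<And>z. poly p z = 0 \<Longrightarrow> poly r z = 0"
  shows "p dvd r"
proof -
  have "p \<noteq> 0" using assms(1) by (simp add: rsquarefree_def)
  then have "(\<Prod>z | poly p z = 0. [:-z, 1:]) dvd r"
    using assms(2) by (intro prod_linear_factors_dvd) (auto intro: poly_roots_finite)
  then have "smult (lead_coeff p) (\<Prod>z | poly p z = 0. [:-z, 1:]) dvd r"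
    using \<open>p \<noteq> 0\<close> by (subst smult_dvd_iff) auto
  then show ?thesis by (simp only: complex_poly_decompose_rsquarefree[OF assms(1)])
qed

lemma map_poly_of_int_hom:
  fixes p r :: "int poly"
  shows "map_poly of_int (p + r) = (map_poly of_int p + map_poly of_int r :: 'a::field_char_0 poly)"
    and "map_poly of_int (p - r) = (map_poly of_int p - map_poly of_int r :: 'a poly)"
    and "map_poly of_int (p * r) = (map_poly of_int p * map_poly of_int r :: 'a::field_char_0 poly)"
  by (auto intro!: poly_eqI simp: coeff_map_poly coeff_mult)

lemma map_poly_of_int_power:
  "map_poly of_int (p ^ n) = (map_poly of_int p ^ n :: 'a::field_char_0 poly)"
  by (induction n) (auto simp: map_poly_of_int_hom)

lemma map_poly_of_int_sum:
  "map_poly of_int (sum f A) = (\<Sum>x\<in>A. map_poly of_int (f x) :: 'a::field_char_0 poly)"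
  by (induction A rule: infinite_finite_induct) (auto simp: map_poly_of_int_hom)

lemma map_poly_of_int_gauss_binomial:
  "map_poly of_int (gauss_binomial p n k)
   = (gauss_binomial (map_poly of_int p) n k :: 'a::field_char_0 poly)"
  by (induction p n k rule: gauss_binomial.induct)
     (auto simp: map_poly_of_int_hom map_poly_of_int_power)

text \<open>
  Division with remainder by a monic polynomial stays within integer polynomials, and the remainder
  is unchanged by passing to the larger field.
\<close>

lemma monic_dvd_of_int_poly:
  fixes p r :: "int poly"
  assumes "lead_coeff p = 1" 
    and dvd: "map_poly of_int p dvd (map_poly of_int r :: 'a::field_char_0 poly)"
  shows "p dvd r"
proof -
  obtain u v where uv: "pseudo_divmod r p = (u, v)" by force
  have "p \<noteq> 0" using assms(1) by auto
  have r: "r = p * u + v" using pseudo_divmod(1)[OF \<open>p \<noteq> 0\<close> uv] assms(1) by simp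
  have deg: "v = 0 \<or> degree v < degree p" using pseudo_divmod(2)[OF \<open>p \<noteq> 0\<close> uv] .
  have "map_poly of_int p dvd (map_poly of_int v :: 'a poly)"
    using dvd unfolding r map_poly_of_int_hom by (metis dvd_add_right_iff dvd_triv_left)
  moreover have "degree (map_poly of_int w :: 'a poly) = degree w" for w :: "int poly"
    by (rule degree_map_poly) auto
  ultimately have "map_poly of_int v = (0 :: 'a poly)"
    using deg dvd_imp_degree_le[of "map_poly of_int p" "map_poly of_int v :: 'a poly"]
    by (metis map_poly_0 not_le)
  then have "v = 0" by (subst (asm) map_poly_eq_0_iff) auto
  then show ?thesis using r by simp
qed

section \<open>The divisibility for natural numbers\<close>

text \<open>
  In \<open>T = D * R\<close> with integer polynomials, the derivative at \<open>1\<close> is \<open>D'(1) * R(1)\<close> because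
  \<open>D(1) = 0\<close>, and \<open>D'(1) = n * (m choose n)\<close>.
\<close>

theorem binomial_dvd_sum:
  assumes "1 \<le> n" "n \<le> m" "\<rho> \<ge> 1"
  shows "int (n * (m choose n)) dvd (\<Sum>k<n. (2 * int k - int m) * int (m choose k) ^ \<rho>)"
proof -
  let ?X = "[:0, 1:] :: int poly" and ?Y = "[:0, 1:] :: complex poly"
  define D where "D = (?X ^ n - 1) * gauss_binomial ?X m n"
  define T where "T = (\<Sum>k<n. (?X ^ k - ?X ^ (m - k)) * gauss_binomial ?X m k ^ \<rho>)"
  have lead_X: "lead_coeff (?X ^ j - 1) = 1" if "0 < j" for j
  proof -
    have "lead_coeff (- 1 + ?X ^ j) = lead_coeff (?X ^ j)"
      using that by (intro lead_coeff_add_le) (simp add: degree_power_eq)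
    also have "\<dots> = 1" by (simp only: lead_coeff_power) simp
    finally show ?thesis by simp
  qed
  have lead_G: "lead_coeff (gauss_binomial ?X m k) = 1" if "k \<le> m" for k
    using that
  proof (induction k)
    case (Suc k)
    have "lead_coeff (gauss_binomial ?X m (Suc k) * (?X ^ Suc k - 1))
        = lead_coeff (gauss_binomial ?X m k * (?X ^ (m - k) - 1))"
      using Suc.prems by (simp only: gauss_binomial_ratio Suc_leD)
    then show ?case
      using Suc lead_X[of "Suc k"] lead_X[of "m - k"] by (simp add: lead_coeff_mult del: power_Suc)
  qed simp
  have lead_D: "lead_coeff D = 1"
    using assms
    by (simp only: D_def lead_coeff_mult lead_X[of n] lead_G[of n] Suc_le_eq One_nat_def)
  have X: "map_poly of_int ?X = ?Y" by (simp add: map_poly_pCons)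
  have D_complex: "map_poly of_int D = (?Y ^ n - 1) * gauss_binomial ?Y m n"
    by (simp only: D_def map_poly_of_int_hom map_poly_of_int_power
          map_poly_of_int_gauss_binomial X) simp
  have nz: "?Y ^ n - 1 \<noteq> 0" "gauss_binomial ?Y m n \<noteq> 0"
    using assms X_power_neq_1[of n] gauss_binomial_nonzero[OF X_power_neq_1, of m n] by auto
  \<comment> \<open>at most one of the two summands is nonzero, since \<open>d dvd n\<close> means \<open>n mod d = 0\<close>\<close>
  have order_D: "order z (map_poly of_int D) =
      (if d dvd n then 1 else 0) + (if m mod d < n mod d then 1 else 0)"
    if "\<And>i. z ^ i = 1 \<longleftrightarrow> d dvd i" for z :: complex and d
    unfolding D_complex using assms nz
    by (subst order_mult) (auto simp: order_power_minus_1 order_gauss_binomial[OF that] that)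
  have "rsquarefree (map_poly of_int D :: complex poly)"
    unfolding rsquarefree_def
  proof (intro conjI allI)
    show "map_poly of_int D \<noteq> (0 :: complex poly)" using nz by (simp add: D_complex)
    fix z :: complex
    obtain d where d: "\<And>i. z ^ i = 1 \<longleftrightarrow> d dvd i" using ex_ord by blast
    show "order z (map_poly of_int D) = 0 \<or> order z (map_poly of_int D) = 1"
      unfolding order_D[OF d] by auto
  qed
  then have "map_poly of_int D dvd (map_poly of_int T :: complex poly)"
  proof (rule rsquarefree_dvd)
    fix z :: complex
    assume z: "poly (map_poly of_int D) z = 0"
    obtain d where d: "\<And>i. z ^ i = 1 \<longleftrightarrow> d dvd i" using ex_ord by blast
    have "order z (map_poly of_int D) \<noteq> 0"
      using z nz by (subst (asm) order_root) (simp add: D_complex)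
    then have "n mod d = 0 \<or> m mod d < n mod d"
      unfolding order_D[OF d] by (auto split: if_splits)
    from gauss_binomial_sum_vanishes[OF d assms(2,3) this]
    show "poly (map_poly of_int T) z = 0"
      unfolding T_def
      by (simp add: map_poly_of_int_sum map_poly_of_int_hom map_poly_of_int_power
            map_poly_of_int_gauss_binomial X poly_sum poly_gauss_binomial)
  qed
  then have "D dvd T" by (rule monic_dvd_of_int_poly[OF lead_D])
  then obtain R where R: "T = D * R" by blast
  \<comment> \<open>every factor \<open>q ^ k - q ^ (m - k)\<close> vanishes at \<open>1\<close>, so only its derivative contributes\<close>
  have "poly (pderiv T) 1 = (\<Sum>k<n. (2 * int k - int m) * int (m choose k) ^ \<rho>)"
    unfolding T_def using assms
    by (auto simp: higher_pderiv_sum[where n = 1, simplified] poly_sum pderiv_mult pderiv_diff pderiv_power pderiv_pCons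
          poly_gauss_binomial gauss_binomial_1 intro!: sum.cong)
  moreover have "poly (pderiv T) 1 = int (n * (m choose n)) * poly R 1"
    by (simp add: R D_def pderiv_mult pderiv_diff pderiv_power pderiv_pCons
          poly_gauss_binomial gauss_binomial_1)
  ultimately show ?thesis by (metis dvd_triv_left)
qed

section \<open>Congruences between rational numbers\<close>

text \<open>
  The localization of the integers at the primes dividing \<open>N\<close>, as a subring of the rationals;
  \<open>rat_cong_zero x N\<close> is membership in the ideal that \<open>N\<close> generates in it.
\<close>

definition local_integers :: "int \<Rightarrow> rat set" where
  "local_integers N = {of_int a / of_int b | a b. b \<noteq> 0 \<and> coprime b N}"

lemma local_integersI:
  "b \<noteq> 0 \<Longrightarrow> coprime b N \<Longrightarrow> x = of_int a / of_int b \<Longrightarrow> x \<in> local_integers N"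
  unfolding local_integers_def by blast

lemma rat_cong_zero_iff: "rat_cong_zero x N \<longleftrightarrow> (\<exists>r\<in>local_integers N. x = of_int N * r)"
  unfolding rat_cong_zero_def local_integers_def coprime_iff_gcd_eq_1[symmetric] by blast

lemma local_integers_of_int [simp]: "of_int a \<in> local_integers N"
  by (rule local_integersI[of 1 _ _ a]) auto

lemma local_integers_of_nat [simp]: "of_nat a \<in> local_integers N"
  using local_integers_of_int[of "int a"] by simp

lemma local_integers_add:
  assumes "x \<in> local_integers N" "y \<in> local_integers N"
  shows "x + y \<in> local_integers N"
proof -
  obtain a b c d where "x = of_int a / of_int b" "y = of_int c / of_int d"
    "b \<noteq> 0" "d \<noteq> 0" "coprime b N" "coprime d N"
    using assms unfolding local_integers_def by blast
  then show ?thesis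
    by (intro local_integersI[of "b * d" N _ "a * d + c * b"]) (auto simp: field_simps)
qed

lemma local_integers_mult:
  assumes "x \<in> local_integers N" "y \<in> local_integers N"
  shows "x * y \<in> local_integers N"
proof -
  obtain a b c d where "x = of_int a / of_int b" "y = of_int c / of_int d"
    "b \<noteq> 0" "d \<noteq> 0" "coprime b N" "coprime d N"
    using assms unfolding local_integers_def by blast
  then show ?thesis
    by (intro local_integersI[of "b * d" N _ "a * c"]) auto
qed

lemma local_integers_uminus: "x \<in> local_integers N \<Longrightarrow> - x \<in> local_integers N"
  using local_integers_mult[of "of_int (- 1)" N x] local_integers_of_int[of "- 1" N] by simp

lemma local_integers_diff:
  "x \<in> local_integers N \<Longrightarrow> y \<in> local_integers N \<Longrightarrow> x - y \<in> local_integers N"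
  using local_integers_add[of x N "- y"] by (simp add: local_integers_uminus)

lemma local_integers_power: "x \<in> local_integers N \<Longrightarrow> x ^ k \<in> local_integers N"
  using local_integers_of_int[of 1] by (induction k) (auto intro: local_integers_mult)

lemma local_integers_prod:
  "(\<And>i. i \<in> A \<Longrightarrow> f i \<in> local_integers N) \<Longrightarrow> prod f A \<in> local_integers N"
  using local_integers_of_int[of 1]
  by (induction A rule: infinite_finite_induct) (auto intro: local_integers_mult)

lemma rat_cong_zero_imp_local_integer: "rat_cong_zero x N \<Longrightarrow> x \<in> local_integers N"
  unfolding rat_cong_zero_iff by (auto intro: local_integers_mult)

lemma rat_cong_zero_0: "rat_cong_zero 0 N"
  unfolding rat_cong_zero_iff using local_integers_of_int[of 0] by force

lemma rat_cong_zero_add: "rat_cong_zero x N \<Longrightarrow> rat_cong_zero y N \<Longrightarrow> rat_cong_zero (x + y) N"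
  unfolding rat_cong_zero_iff by (metis distrib_left local_integers_add)

lemma rat_cong_zero_mult:
  "rat_cong_zero x N \<Longrightarrow> y \<in> local_integers N \<Longrightarrow> rat_cong_zero (x * y) N"
  unfolding rat_cong_zero_iff by (metis mult.assoc local_integers_mult)

lemma rat_cong_zero_uminus: "rat_cong_zero x N \<Longrightarrow> rat_cong_zero (- x) N"
  using rat_cong_zero_mult[of x N "of_int (- 1)"] local_integers_of_int[of "- 1" N] by simp

lemma rat_cong_zero_diff: "rat_cong_zero x N \<Longrightarrow> rat_cong_zero y N \<Longrightarrow> rat_cong_zero (x - y) N"
  using rat_cong_zero_add[of x N "- y"] by (simp add: rat_cong_zero_uminus)

lemma rat_cong_zero_sum:
  "(\<And>i. i \<in> A \<Longrightarrow> rat_cong_zero (f i) N) \<Longrightarrow> rat_cong_zero (sum f A) N"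
  by (induction A rule: infinite_finite_induct) (auto intro: rat_cong_zero_add rat_cong_zero_0)

lemma rat_cong_zero_of_int_iff: "rat_cong_zero (of_int z) N \<longleftrightarrow> N dvd z"
proof
  assume "rat_cong_zero (of_int z) N"
  then obtain a b where b: "b \<noteq> 0" "coprime b N" and "of_int z = of_int N * (of_int a / of_int b :: rat)"
    unfolding rat_cong_zero_def coprime_iff_gcd_eq_1[symmetric] by blast
  then have "of_int (z * b) = (of_int (N * a) :: rat)" by (simp add: field_simps)
  then have "z * b = N * a" by (simp only: of_int_eq_iff)
  then show "N dvd z" using b(2) by (metis coprime_commute coprime_dvd_mult_left_iff dvd_triv_left)
next
  assume "N dvd z"
  then show "rat_cong_zero (of_int z) N"
    unfolding rat_cong_zero_iff using local_integers_of_int by (auto elim!: dvdE)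
qed

lemma rat_cong_zero_mult_diff:
  assumes "rat_cong_zero (x - x') N" "rat_cong_zero (y - y') N"
    and "x' \<in> local_integers N" "y' \<in> local_integers N"
  shows "rat_cong_zero (x * y - x' * y') N"
proof -
  have "x * y - x' * y' = (x - x') * (y - y') + (x - x') * y' + (y - y') * x'"
    by (simp add: algebra_simps)
  then show ?thesis
    using assms by (auto intro!: rat_cong_zero_add rat_cong_zero_mult rat_cong_zero_imp_local_integer)
qed

lemma rat_cong_zero_power_diff:
  assumes "rat_cong_zero (x - y) N" "y \<in> local_integers N"
  shows "rat_cong_zero (x ^ k - y ^ k) N"
  using assms
  by (induction k) (auto intro: rat_cong_zero_0 rat_cong_zero_mult_diff local_integers_power)

text \<open>
  Every \<open>j\<close> is, up to a unit of the localization, a divisor of a power of \<open>N\<close>.  Splitting off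
  \<open>gcd j N\<close> repeatedly avoids a factorization into primes.
\<close>

lemma power_div_local_integer:
  assumes "N \<noteq> 0" "0 < j"
  shows "\<exists>e. of_int N ^ e / of_nat j \<in> local_integers N"
  using assms(2)
proof (induction j rule: less_induct)
  case (less j)
  define g where "g = gcd (int j) N"
  show ?case
  proof (cases "g = 1")
    case True
    then have "of_int N ^ 0 / of_nat j \<in> local_integers N"
      using less.prems
      by (intro local_integersI[of "int j" N _ 1]) (auto simp: g_def coprime_iff_gcd_eq_1[symmetric])
    then show ?thesis by blast
  next
    case False
    have "g > 0" using assms(1) by (simp add: g_def)
    then have "nat g > 1" using False by linarith
    have gj: "nat g dvd j" and gN: "g dvd N"
      using \<open>g > 0\<close> by (auto simp: g_def nat_dvd_iff)
    then obtain i where i: "j = nat g * i" by blast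
    then have "0 < i" "i < j" using less.prems \<open>nat g > 1\<close> by auto
    then obtain e where e: "of_int N ^ e / of_nat i \<in> local_integers N" using less.IH by blast
    obtain c where c: "N = g * c" using gN by blast
    have "rat_of_nat j = of_int g * of_nat i" using i \<open>g > 0\<close> by simp
    then have "of_int N ^ Suc e / of_nat j = of_int c * (of_int N ^ e / rat_of_nat i)"
      using \<open>g > 0\<close> by (simp add: c field_simps)
    then show ?thesis using e by (metis local_integers_mult local_integers_of_int)
  qed
qed

text \<open>
  With \<open>y = x - m\<close>, Vandermonde's identity writes \<open>x gchoose k\<close> as \<open>m choose k\<close> plus multiples of
  \<open>y gchoose i\<close> for \<open>0 < i \<le> k\<close>.  Each of these has \<open>y\<close> as a factor of its numerator; a part
  \<open>N ^ e\<close> of \<open>y\<close> cancels the denominator \<open>i!\<close> and one factor \<open>N\<close> remains.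
\<close>

lemma gbinomial_cong:
  assumes e: "of_int N ^ e / fact n \<in> local_integers N"
    and r: "r \<in> local_integers N" and x: "x = of_nat m + of_int N ^ Suc e * r" and "k \<le> n"
  shows "rat_cong_zero ((x gchoose k) - of_nat (m choose k)) N"
proof -
  define y where "y = of_int N ^ Suc e * r"
  have y: "y \<in> local_integers N"
    unfolding y_def using r by (intro local_integers_mult local_integers_power) auto
  have small: "rat_cong_zero (y gchoose i) N" if "0 < i" "i \<le> k" for i
  proof -
    have "fact i dvd (fact n :: nat)"
      using that \<open>k \<le> n\<close> by (intro fact_dvd) simp
    then obtain c where "fact n = fact i * (c :: nat)" ..
    then have "rat_of_nat (fact n) = rat_of_nat (fact i * c)" by (simp only:)
    then have c: "(fact n :: rat) = fact i * of_nat c" by (simp only: of_nat_fact of_nat_mult)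
    have "c \<noteq> 0"
    proof
      assume "c = 0"
      with c have "(fact n :: rat) = 0" by simp
      then show False by simp
    qed
    have "(fact i :: rat) * (y gchoose i) = (\<Prod>t = 0..<i. y - of_nat t)"
      by (rule gbinomial_mult_fact)
    also have "\<dots> = y * (\<Prod>t = 1..<i. y - of_nat t)"
      using that by (simp add: prod.atLeast_Suc_lessThan)
    finally have "(fact i :: rat) * (y gchoose i) = y * (\<Prod>t = 1..<i. y - of_nat t)" .
    then have "y gchoose i = of_int N * ((of_int N ^ e / fact n) * of_nat c * r * (\<Prod>t = 1..<i. y - of_nat t))"
      using \<open>c \<noteq> 0\<close> by (simp add: c y_def field_simps)
    moreover have "(of_int N ^ e / fact n) * of_nat c * r * (\<Prod>t = 1..<i. y - of_nat t) \<in> local_integers N"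
      by (intro local_integers_mult e r local_integers_of_nat local_integers_prod local_integers_diff y)
    ultimately show ?thesis unfolding rat_cong_zero_iff by blast
  qed
  have "x gchoose k = (\<Sum>i = 0..k. (y gchoose i) * (of_nat m gchoose (k - i)))"
    unfolding gbinomial_Vandermonde x y_def by (simp add: add.commute)
  also have "\<dots> = of_nat (m choose k) + (\<Sum>i = 1..k. (y gchoose i) * of_nat (m choose (k - i)))"
    by (simp add: sum.atLeast_Suc_atMost binomial_gbinomial)
  finally have "(x gchoose k) - of_nat (m choose k)
      = (\<Sum>i = 1..k. (y gchoose i) * of_nat (m choose (k - i)))" by simp
  then show ?thesis
    by (auto intro!: rat_cong_zero_sum rat_cong_zero_mult small)
qed

lemma ex_nat_approx:
  assumes "x \<in> local_integers N" "N \<noteq> 0"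
  shows "\<exists>m\<ge>n. \<exists>r\<in>local_integers N. x = of_nat m + of_int N ^ e * r"
proof -
  obtain a b where b: "b \<noteq> 0" "coprime b N" and x: "x = of_int a / of_int b"
    using assms(1) unfolding local_integers_def by blast
  then have "coprime b (N ^ e)" by simp
  then obtain u v where uv: "b * u + N ^ e * v = 1"
    using bezout_int[of b "N ^ e"] unfolding coprime_iff_gcd_eq_1 by (metis mult.commute)
  define M where "M = \<bar>N ^ e\<bar>"
  have M: "M > 0" "N ^ e dvd M" using assms(2) by (auto simp: M_def)
  \<comment> \<open>\<open>u\<close> is inverse to \<open>b\<close> modulo \<open>N ^ e\<close>; adding \<open>M * s\<close> to \<open>a * u\<close> makes it at least \<open>n\<close>\<close>
  define s where "s = \<bar>a * u\<bar> + int n"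
  define k where "k = a * u + M * s"
  have "1 * s \<le> M * s"
    using M by (intro mult_right_mono) (auto simp: s_def)
  moreover have "a * u + s \<ge> int n" using abs_ge_minus_self[of "a * u"] by (simp add: s_def)
  ultimately have k: "k \<ge> int n" unfolding k_def by linarith
  obtain c where c: "M = N ^ e * c" using M by blast
  have "a - b * k = N ^ e * (v * a - b * c * s)"
  proof -
    have "a - b * k = (b * u + N ^ e * v) * a - b * k" by (simp add: uv)
    also have "\<dots> = N ^ e * (v * a - b * c * s)"
      unfolding k_def c by (simp add: algebra_simps)
    finally show ?thesis .
  qed
  then obtain w where w: "a - b * k = N ^ e * w" by blast
  have "rat_of_int (a - b * k) = rat_of_int (N ^ e * w)" by (simp only: w)
  then have "x = of_nat (nat k) + of_int N ^ e * (of_int w / of_int b)"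
    using b k by (simp add: x field_simps)
  moreover have "of_int w / of_int b \<in> local_integers N"
    using b unfolding local_integers_def by blast
  ultimately show ?thesis using k by (intro exI[of _ "nat k"] conjI bexI[of _ "of_int w / of_int b"]) auto
qed

section \<open>Transfer to rational arguments\<close>

lemma gbinomial_eq_0_imp_Ints:
  fixes x :: "'a::field_char_0"
  assumes "x gchoose n = 0"
  shows "x \<in> \<int>"
proof -
  have "(\<Prod>i = 0..<n. x - of_nat i) = 0" using gbinomial_mult_fact[of n x] assms by simp
  then show ?thesis by auto
qed

text \<open>
  A common prime factor is impossible since \<open>N_num \<alpha> n\<close> divides \<open>\<Prod>i<n. a + i * b\<close>: the denominators
  \<open>b ^ n\<close> and \<open>(n - 1)!\<close> of \<open>n * (- \<alpha> gchoose n)\<close> can only shrink the numerator, and every factor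
  \<open>a + i * b\<close> is coprime to \<open>b\<close>.
\<close>

lemma coprime_denominator_N_num:
  assumes "\<alpha> \<notin> \<int>" "n \<ge> 1"
    and \<alpha>: "\<alpha> = of_int a / of_int b" "b > 0" "coprime a b"
  shows "coprime b (N_num \<alpha> n)"
proof -
  obtain N D where ND: "quotient_of (of_nat n * \<bar>(- \<alpha>) gchoose n\<bar>) = (N, D)" by force
  then have D: "D > 0" "coprime N D" and eq: "of_nat n * \<bar>(- \<alpha>) gchoose n\<bar> = of_int N / of_int D"
    by (auto dest: quotient_of_denom_pos quotient_of_coprime quotient_of_div)
  define P where "P = (\<Prod>i = 0..<n. - a - int i * b)"
  have "(- \<alpha>) gchoose n = (\<Prod>i = 0..<n. - \<alpha> - of_nat i) / fact n"
    using gbinomial_mult_fact[of n "- \<alpha>"] by (simp add: field_simps)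
  also have "(\<Prod>i = 0..<n. - \<alpha> - of_nat i) = (\<Prod>i = 0..<n. of_int (- a - int i * b) / of_int b)"
    using \<alpha> by (intro prod.cong) (auto simp: field_simps)
  also have "\<dots> = of_int P / of_int b ^ n"
    unfolding P_def of_int_prod prod_dividef by simp
  finally have C: "\<bar>(- \<alpha>) gchoose n\<bar> = of_int \<bar>P\<bar> / (of_int b ^ n * fact n)"
    using \<alpha>(2) by (simp add: abs_divide)
  have "of_nat n * of_int (\<bar>P\<bar> * D) = (of_int (N * b ^ n) * fact n :: rat)"
    using eq[unfolded C] D(1) \<alpha>(2) by (simp add: field_simps)
  then have "rat_of_int (int n * (\<bar>P\<bar> * D)) = rat_of_int (N * b ^ n * fact n)" by simp
  then have "int n * (\<bar>P\<bar> * D) = N * b ^ n * fact n" by (simp only: of_int_eq_iff)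
  also have "(fact n :: int) = int n * fact (n - 1)" using assms(2) by (simp add: fact_reduce)
  finally have "\<bar>P\<bar> * D = N * (b ^ n * fact (n - 1))" using assms(2) by simp
  then have "N dvd \<bar>P\<bar> * D" by simp
  then have "N dvd P" using D(2) by (simp add: coprime_dvd_mult_left_iff)
  moreover have "coprime P b"
    unfolding P_def
  proof (rule prod_coprime_left)
    fix i
    show "coprime (- a - int i * b) b"
    proof (rule coprimeI)
      fix c assume "c dvd - a - int i * b" "c dvd b"
      then have "c dvd (- a - int i * b) + int i * b" by (intro dvd_add dvd_mult)
      then have "c dvd a" by simp
      with \<open>c dvd b\<close> show "is_unit c" using \<alpha>(3) coprime_common_divisor by blast
    qed
  qed
  ultimately have "coprime N b" by (metis coprime_divisors dvd_refl)
  then show ?thesis by (simp add: N_num_def ND coprime_commute)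
qed

theorem theorem1:
  fixes \<rho> n :: nat and \<alpha> :: rat
  assumes "\<rho> \<ge> 1" and "\<alpha> \<notin> \<int>" and "n \<ge> 1"
  shows "rat_cong_zero (\<Sum>k = 0..<n. (2 * of_nat k + \<alpha>) * ((- \<alpha>) gchoose k) ^ \<rho>) (N_num \<alpha> n)"
proof -
  define N where "N = N_num \<alpha> n"
  obtain D where ND: "quotient_of (of_nat n * \<bar>(- \<alpha>) gchoose n\<bar>) = (N, D)"
    by (metis N_def N_num_def prod.collapse)
  then have D: "D > 0" "coprime N D" and eq: "of_nat n * \<bar>(- \<alpha>) gchoose n\<bar> = of_int N / of_int D"
    by (auto dest: quotient_of_denom_pos quotient_of_coprime quotient_of_div)
  have "(- \<alpha>) gchoose n \<noteq> 0" using gbinomial_eq_0_imp_Ints[of "- \<alpha>" n] assms(2) by auto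
  then have N0: "N \<noteq> 0" using eq assms(3) by auto
  obtain a b where ab: "\<alpha> = of_int a / of_int b" "b > 0" "coprime a b"
    by (metis quotient_of_coprime quotient_of_denom_pos quotient_of_div surj_pair)
  have bN: "coprime b N"
    unfolding N_def by (rule coprime_denominator_N_num[OF assms(2,3) ab])
  then have \<alpha>: "- \<alpha> \<in> local_integers N"
    using ab by (intro local_integersI[of b N _ "- a"]) auto
  obtain e where e: "of_int N ^ e / rat_of_nat (fact n) \<in> local_integers N"
    using power_div_local_integer[OF N0, of "fact n"] by auto
  obtain m r where m: "m \<ge> n" and r: "r \<in> local_integers N"
    and x: "- \<alpha> = of_nat m + of_int N ^ Suc e * r"
    using ex_nat_approx[OF \<alpha> N0, of n "Suc e"] by blast
  have binom: "rat_cong_zero (((- \<alpha>) gchoose k) - of_nat (m choose k)) N" if "k \<le> n" for k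
    using e by (intro gbinomial_cong[OF _ r x that]) simp
  have "of_int (int (n * (m choose n)))
      = of_nat n * ((- \<alpha>) gchoose n) - (((- \<alpha>) gchoose n) - of_nat (m choose n)) * of_nat n"
    by (simp add: algebra_simps)
  moreover have "rat_cong_zero (of_nat n * ((- \<alpha>) gchoose n)) N"
  proof -
    have "rat_cong_zero (of_nat n * \<bar>(- \<alpha>) gchoose n\<bar>) N"
      unfolding rat_cong_zero_iff eq using D
      by (intro bexI[of _ "1 / of_int D"] local_integersI[of D _ _ 1]) (auto simp: coprime_commute)
    then show ?thesis
      using rat_cong_zero_uminus by (fastforce simp: abs_if split: if_splits)
  qed
  ultimately have "rat_cong_zero (of_int (int (n * (m choose n)))) N"
    using binom[of n] by (auto intro!: rat_cong_zero_diff rat_cong_zero_mult)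
  then have "N dvd int (n * (m choose n))" by (simp only: rat_cong_zero_of_int_iff)
  also have "\<dots> dvd (\<Sum>k<n. (2 * int k - int m) * int (m choose k) ^ \<rho>)"
    by (rule binomial_dvd_sum[OF assms(3) m assms(1)])
  finally have int_sum: "rat_cong_zero (of_int (\<Sum>k<n. (2 * int k - int m) * int (m choose k) ^ \<rho>)) N"
    by (simp only: rat_cong_zero_of_int_iff)
  have "rat_cong_zero (- \<alpha> - of_nat m) N"
    unfolding rat_cong_zero_iff x using r
    by (auto intro!: bexI[of _ "of_int N ^ e * r"] local_integers_mult local_integers_power)
  from rat_cong_zero_uminus[OF this]
  have lin: "rat_cong_zero ((2 * of_nat k + \<alpha>) - of_int (2 * int k - int m)) N" for k
    by (simp add: algebra_simps)
  have "rat_cong_zero ((2 * of_nat k + \<alpha>) * ((- \<alpha>) gchoose k) ^ \<rho>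
      - of_int (2 * int k - int m) * of_nat (m choose k) ^ \<rho>) N" if "k < n" for k
    using that
    by (intro rat_cong_zero_mult_diff rat_cong_zero_power_diff lin binom
          local_integers_power local_integers_of_int local_integers_of_nat) auto
  then have "rat_cong_zero (\<Sum>k<n. (2 * of_nat k + \<alpha>) * ((- \<alpha>) gchoose k) ^ \<rho>
      - of_int (2 * int k - int m) * of_nat (m choose k) ^ \<rho>) N"
    by (auto intro: rat_cong_zero_sum)
  from rat_cong_zero_add[OF this int_sum]
  show ?thesis by (simp add: N_def sum_subtractf lessThan_atLeast0)
qed

end
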